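(* Let $(I,f_{1,\infty})$ be a $k$-periodic non-autonomous system, where $I$ is any interval. If the system $(I,f_{1,\infty})$ has the weak specification property (WSP) (respectively, the quasi-weak specification property (QSP)), then it is Devaney chaotic.
   Context: A non-autonomous (discrete) system $(X,f_{1,\infty})$ consists of a compact metric space $(X,d)$ and a sequence $f_{1,\infty}=(f_n)_{n\ge 1}$ of continuous surjective maps $f_n:X\to X$ (in the claim, $X=I$ with the usual metric). Write $\mathbb{N}=\{1,2,\dots\}$, $f_1^0=\mathrm{id}$ and $f_1^n=f_n\circ\cdots\circ f_1$ for $n\ge1$. The system is $k$-periodic ($k\in\mathbb{N}$) if $f_{n+k}(x)=f_n(x)$ for all $x\in X$, $n\in\mathbb{N}$. WSP: for every $\epsilon>0$ there is $N\in\mathbb{N}$ such that for every $s\in\mathbb{N}$, every choice of points $x_1,\dots,x_s\in X$ and every sequence $a_1\le b_1<a_2\le b_2<\cdots<a_s\le b_s$ of non-negative integers with $a_j-b_{j-1}>N$ for $2\le j\le s$, there is $z\in X$ with $d(f_1^j(z),f_1^j(x_i))<\epsilon$ for all $a_i\le j\le b_i$, $1\le i\le s$. QSP: for every $\epsilon>0$ there is a positive integer $M(\epsilon)$ such that for any $x_1,x_2\in X$ and any $n\ge M(\epsilon)$ there is $z\in X$ with $d(z,x_1)<\epsilon$ and $d(f_1^n(z),f_1^n(x_2))<\epsilon$. Devaney chaotic means: (1) topologically transitive: for every pair of non-empty open $U,V\subseteq X$ there is $n\in\mathbb{N}$ with $f_1^n(U)\cap V\ne\emptyset$; (2) the set of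 periodic points is dense, where $x$ is periodic if there is $n\in\mathbb{N}$ with $f_1^{nm}(x)=x$ for every $m\in\mathbb{N}$; (3) sensitive dependence on initial conditions: there is $\delta>0$ such that for every $x\in X$ and every neighborhood $U$ of $x$ there are $y\in U$ and $n\in\mathbb{N}$ with $d(f_1^n(x),f_1^n(y))>\delta$. *)

theory Defs
  imports "HOL-Analysis.Analysis"
begin

text \<open>
  The space is a compact subset X of a metric space type, carrying the subspace topology.
  The sequence of maps is indexed by the positive integers: \<open>f 0\<close> is never used, and the values of
  \<open>f n\<close> outside X are irrelevant.
\<close>

definition nonautonomous_system :: "'a::metric_space set \<Rightarrow> (nat \<Rightarrow> 'a \<Rightarrow> 'a) \<Rightarrow> bool" where
  "nonautonomous_system X f \<longleftrightarrow>
     compact X \<and> (\<forall>n\<ge>1. continuous_on X (f n) \<and> f n ` X = X)"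

text \<open>\<open>orbit_map f n\<close> is \<open>f n \<circ> \<dots> \<circ> f 1\<close>.\<close>

primrec orbit_map :: "(nat \<Rightarrow> 'a \<Rightarrow> 'a) \<Rightarrow> nat \<Rightarrow> 'a \<Rightarrow> 'a" where
  "orbit_map f 0 = id"
| "orbit_map f (Suc n) = f (Suc n) \<circ> orbit_map f n"

definition periodic_system :: "'a set \<Rightarrow> (nat \<Rightarrow> 'a \<Rightarrow> 'a) \<Rightarrow> nat \<Rightarrow> bool" where
  "periodic_system X f k \<longleftrightarrow> k \<ge> 1 \<and> (\<forall>n\<ge>1. \<forall>x\<in>X. f (n + k) x = f n x)"

definition weak_specification :: "'a::metric_space set \<Rightarrow> (nat \<Rightarrow> 'a \<Rightarrow> 'a) \<Rightarrow> bool" where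
  "weak_specification X f \<longleftrightarrow>
     (\<forall>\<epsilon>>0. \<exists>N\<ge>1. \<forall>s\<ge>1. \<forall>(x :: nat \<Rightarrow> 'a) (a :: nat \<Rightarrow> nat) (b :: nat \<Rightarrow> nat).
        (\<forall>i\<in>{1..s}. x i \<in> X) \<longrightarrow>
        (\<forall>i\<in>{1..s}. a i \<le> b i) \<longrightarrow>
        (\<forall>j\<in>{2..s}. b (j - 1) < a j \<and> a j - b (j - 1) > N) \<longrightarrow>
        (\<exists>z\<in>X. \<forall>i\<in>{1..s}. \<forall>j\<in>{a i..b i}.
            dist (orbit_map f j z) (orbit_map f j (x i)) < \<epsilon>))"

definition quasi_weak_specification :: "'a::metric_space set \<Rightarrow> (nat \<Rightarrow> 'a \<Rightarrow> 'a) \<Rightarrow> bool" where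
  "quasi_weak_specification X f \<longleftrightarrow>
     (\<forall>\<epsilon>>0. \<exists>M\<ge>1. \<forall>x1\<in>X. \<forall>x2\<in>X. \<forall>n\<ge>M.
        \<exists>z\<in>X. dist z x1 < \<epsilon> \<and> dist (orbit_map f n z) (orbit_map f n x2) < \<epsilon>)"

definition topologically_transitive :: "'a::metric_space set \<Rightarrow> (nat \<Rightarrow> 'a \<Rightarrow> 'a) \<Rightarrow> bool" where
  "topologically_transitive X f \<longleftrightarrow>
     (\<forall>U V. openin (top_of_set X) U \<longrightarrow> openin (top_of_set X) V \<longrightarrow> U \<noteq> {} \<longrightarrow> V \<noteq> {} \<longrightarrow>
        (\<exists>n\<ge>1. orbit_map f n ` U \<inter> V \<noteq> {}))"

definition periodic_points :: "'a set \<Rightarrow> (nat \<Rightarrow> 'a \<Rightarrow> 'a) \<Rightarrow> 'a set" where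
  "periodic_points X f = {x \<in> X. \<exists>n\<ge>1. \<forall>m\<ge>1. orbit_map f (n * m) x = x}"

definition sensitive :: "'a::metric_space set \<Rightarrow> (nat \<Rightarrow> 'a \<Rightarrow> 'a) \<Rightarrow> bool" where
  "sensitive X f \<longleftrightarrow>
     (\<exists>\<delta>>0. \<forall>x\<in>X. \<forall>U. openin (top_of_set X) U \<longrightarrow> x \<in> U \<longrightarrow>
        (\<exists>y\<in>U. \<exists>n\<ge>1. dist (orbit_map f n x) (orbit_map f n y) > \<delta>))"

definition devaney_chaotic :: "'a::metric_space set \<Rightarrow> (nat \<Rightarrow> 'a \<Rightarrow> 'a) \<Rightarrow> bool" where
  "devaney_chaotic X f \<longleftrightarrow>
     topologically_transitive X f \<and> X \<subseteq> closure (periodic_points X f) \<and> sensitive X f"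

end

theory Submission
  imports Defs
begin

text \<open>
  Either specification property makes the system topologically mixing: since every \<open>f\<^sub>1\<^sup>n\<close> is onto, for
  large n each ball of radius \<open>\<epsilon>\<close> has an image under \<open>f\<^sub>1\<^sup>n\<close> that is \<open>\<epsilon>\<close>-dense. Transitivity is
  immediate, and sensitivity holds because such an image comes close to two fixed distinct points.
  On an interval, take a small ball away from the endpoints and n a multiple of the period: some
  point of the ball is sent to its left, near the left endpoint, and another to its right, so the
  intermediate value theorem gives a fixed point of \<open>f\<^sub>1\<^sup>n\<close> in the ball, and periodicity of
  the system makes it a periodic point.
\<close>

text \<open>Unlike in the quasi-weak property, the target \<open>y\<close> is chosen independently
  of \<open>n\<close>. For compact \<open>X\<close>, the uniformity of \<open>M\<close> in
  \<open>x\<close> and \<open>y\<close> costs nothing, by finite covers.\<close>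

definition mixing :: "'a::metric_space set \<Rightarrow> (nat \<Rightarrow> 'a \<Rightarrow> 'a) \<Rightarrow> bool" where
  "mixing X f \<longleftrightarrow>
     (\<forall>\<epsilon>>0. \<exists>M\<ge>1. \<forall>x\<in>X. \<forall>y\<in>X. \<forall>n\<ge>M.
        \<exists>z\<in>X. dist z x < \<epsilon> \<and> dist (orbit_map f n z) y < \<epsilon>)"

lemma mixingE:
  assumes "mixing X f" and "\<epsilon> > 0"
  obtains M where "M \<ge> 1"
    and "\<And>x y n. x \<in> X \<Longrightarrow> y \<in> X \<Longrightarrow> n \<ge> M \<Longrightarrow>
           \<exists>z\<in>X. dist z x < \<epsilon> \<and> dist (orbit_map f n z) y < \<epsilon>"
  using assms unfolding mixing_def by meson

lemma orbit_map_image: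
  assumes "nonautonomous_system X f"
  shows "orbit_map f n ` X = X"
proof (induction n)
  case (Suc n)
  have "f (Suc n) ` X = X"
    using assms by (simp add: nonautonomous_system_def)
  then show ?case
    using Suc by (simp only: orbit_map.simps image_comp [symmetric])
qed simp

lemma continuous_on_orbit_map:
  assumes "nonautonomous_system X f"
  shows "continuous_on X (orbit_map f n)"
proof (induction n)
  case 0
  show ?case by (simp add: id_def)
next
  case (Suc n)
  have "continuous_on X (f (Suc n))"
    using assms by (simp add: nonautonomous_system_def)
  then show ?case
    using Suc continuous_on_compose orbit_map_image [OF assms] by (metis orbit_map.simps(2))
qed

text \<open>Two orbit segments of a single point each suffice: time 0 for \<open>x1\<close> and time
  \<open>n\<close> for \<open>x2\<close>.\<close>

lemma weak_specification_imp_quasi: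
  fixes X :: "'a::metric_space set"
  assumes "weak_specification X f"
  shows "quasi_weak_specification X f"
  unfolding quasi_weak_specification_def
proof (intro allI impI)
  fix \<epsilon> :: real assume "\<epsilon> > 0"
  then obtain N where N: "\<forall>s\<ge>1. \<forall>(x :: nat \<Rightarrow> 'a) (a :: nat \<Rightarrow> nat) (b :: nat \<Rightarrow> nat).
      (\<forall>i\<in>{1..s}. x i \<in> X) \<longrightarrow> (\<forall>i\<in>{1..s}. a i \<le> b i) \<longrightarrow>
      (\<forall>j\<in>{2..s}. b (j - 1) < a j \<and> a j - b (j - 1) > N) \<longrightarrow>
      (\<exists>z\<in>X. \<forall>i\<in>{1..s}. \<forall>j\<in>{a i..b i}.
        dist (orbit_map f j z) (orbit_map f j (x i)) < \<epsilon>)"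
    using assms unfolding weak_specification_def by blast
  show "\<exists>M\<ge>1. \<forall>x1\<in>X. \<forall>x2\<in>X. \<forall>n\<ge>M.
          \<exists>z\<in>X. dist z x1 < \<epsilon> \<and> dist (orbit_map f n z) (orbit_map f n x2) < \<epsilon>"
  \<comment> \<open>The gap between the two times is \<open>n\<close> itself and must exceed
    \<open>N\<close> strictly.\<close>
  proof (intro exI [of _ "Suc N"] conjI ballI allI impI)
    fix x1 x2 n assume x: "x1 \<in> X" "x2 \<in> X" and n: "Suc N \<le> n"
    define x where "x i = (if i = 1 then x1 else x2)" for i :: nat
    define a where "a i = (if i = 1 then 0 else n)" for i :: nat
    have "\<exists>z\<in>X. \<forall>i\<in>{1..2}. \<forall>j\<in>{a i..a i}. dist (orbit_map f j z) (orbit_map f j (x i)) < \<epsilon>"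
      by (rule N [rule_format, of 2 x a a]) (use x n in \<open>auto simp: x_def a_def\<close>)
    then obtain z where "z \<in> X"
      and z: "\<And>i. i \<in> {1..2} \<Longrightarrow> dist (orbit_map f (a i) z) (orbit_map f (a i) (x i)) < \<epsilon>"
      by auto
    then show "\<exists>z\<in>X. dist z x1 < \<epsilon> \<and> dist (orbit_map f n z) (orbit_map f n x2) < \<epsilon>"
      using z [of 1] z [of 2] by (auto simp: x_def a_def)
  qed simp
qed

text \<open>As \<open>orbit_map f n\<close> is onto, every target \<open>y\<close> is the image of
  some \<open>x2\<close>, which may depend on \<open>n\<close>.\<close>

lemma quasi_weak_specification_imp_mixing:
  assumes "nonautonomous_system X f" and "quasi_weak_specification X f"
  shows "mixing X f"
  unfolding mixing_def
proof (intro allI impI)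
  fix \<epsilon> :: real assume "\<epsilon> > 0"
  then obtain M where "M \<ge> 1" and M: "\<And>x1 x2 n. x1 \<in> X \<Longrightarrow> x2 \<in> X \<Longrightarrow> n \<ge> M \<Longrightarrow>
      \<exists>z\<in>X. dist z x1 < \<epsilon> \<and> dist (orbit_map f n z) (orbit_map f n x2) < \<epsilon>"
    using assms(2) unfolding quasi_weak_specification_def by meson
  have "\<exists>z\<in>X. dist z x < \<epsilon> \<and> dist (orbit_map f n z) y < \<epsilon>"
    if "x \<in> X" "y \<in> X" "n \<ge> M" for x y n
  proof -
    obtain x2 where "x2 \<in> X" "y = orbit_map f n x2"
      using orbit_map_image [OF assms(1), of n] \<open>y \<in> X\<close> by blast
    then show ?thesis using M that by blast
  qed
  then show "\<exists>M\<ge>1. \<forall>x\<in>X. \<forall>y\<in>X. \<forall>n\<ge>M.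
      \<exists>z\<in>X. dist z x < \<epsilon> \<and> dist (orbit_map f n z) y < \<epsilon>"
    using \<open>M \<ge> 1\<close> by blast
qed

lemma mixing_imp_transitive:
  assumes "mixing X f" and "nonautonomous_system X f"
  shows "topologically_transitive X f"
  unfolding topologically_transitive_def
proof (intro allI impI)
  fix U V
  assume U: "openin (top_of_set X) U" and V: "openin (top_of_set X) V"
    and "U \<noteq> {}" "V \<noteq> {}"
  then obtain x y where "x \<in> U" "y \<in> V" by blast
  then have xy: "x \<in> X" "y \<in> X"
    using U V openin_imp_subset by blast+
  obtain d where d: "d > 0" "\<And>z. z \<in> X \<Longrightarrow> dist z x < d \<Longrightarrow> z \<in> U"
    using U \<open>x \<in> U\<close> by (metis openin_euclidean_subtopology_iff)
  obtain e where e: "e > 0" "\<And>z. z \<in> X \<Longrightarrow> dist z y < e \<Longrightarrow> z \<in> V"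
    using V \<open>y \<in> V\<close> by (metis openin_euclidean_subtopology_iff)
  have "min d e > 0" using d e by simp
  then obtain M where "M \<ge> 1" and M: "\<And>x y n. x \<in> X \<Longrightarrow> y \<in> X \<Longrightarrow> n \<ge> M \<Longrightarrow>
      \<exists>z\<in>X. dist z x < min d e \<and> dist (orbit_map f n z) y < min d e"
    using mixingE [OF assms(1)] by metis
  then obtain z where z: "z \<in> X" "dist z x < min d e" "dist (orbit_map f M z) y < min d e"
    using xy by blast
  \<comment> \<open>\<open>V\<close> is open only relative to \<open>X\<close>, so closeness to
    \<open>y\<close> alone does not place the image in \<open>V\<close>.\<close>
  moreover have "orbit_map f M z \<in> X"
    using z(1) orbit_map_image [OF assms(2)] by blast
  ultimately have "z \<in> U" "orbit_map f M z \<in> V"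
    using d e by auto
  then show "\<exists>n\<ge>1. orbit_map f n ` U \<inter> V \<noteq> {}"
    using \<open>M \<ge> 1\<close> by blast
qed

text \<open>Near \<open>x\<close> there are points whose images at a common time are close to
  \<open>u\<close> and to \<open>v\<close>; the image of \<open>x\<close> cannot be close to
  both.\<close>

lemma mixing_imp_sensitive:
  assumes "mixing X f" and "u \<in> X" "v \<in> X" "u \<noteq> v"
  shows "sensitive X f"
  unfolding sensitive_def
proof (intro exI [of _ "dist u v / 4"] conjI ballI allI impI)
  show "dist u v / 4 > 0" using assms by simp
next
  fix x U
  assume "x \<in> X" and U: "openin (top_of_set X) U" "x \<in> U"
  obtain d where d: "d > 0" "\<And>z. z \<in> X \<Longrightarrow> dist z x < d \<Longrightarrow> z \<in> U"
    using U by (metis openin_euclidean_subtopology_iff)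
  define e where "e = min d (dist u v / 8)"
  have "e > 0" using d assms by (simp add: e_def)
  then obtain M where "M \<ge> 1" and M: "\<And>x y n. x \<in> X \<Longrightarrow> y \<in> X \<Longrightarrow> n \<ge> M \<Longrightarrow>
      \<exists>z\<in>X. dist z x < e \<and> dist (orbit_map f n z) y < e"
    using mixingE [OF assms(1)] by metis
  obtain p where p: "p \<in> X" "dist p x < e" "dist (orbit_map f M p) u < e"
    using M \<open>x \<in> X\<close> \<open>u \<in> X\<close> by blast
  obtain q where q: "q \<in> X" "dist q x < e" "dist (orbit_map f M q) v < e"
    using M \<open>x \<in> X\<close> \<open>v \<in> X\<close> by blast
  \<comment> \<open>The two outer terms are below \<open>dist u v / 8\<close> each, so the two
    middle ones add up to more than three quarters of \<open>dist u v\<close>, and one of them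
    exceeds a quarter.\<close>
  have "dist u v \<le> dist (orbit_map f M p) u + dist (orbit_map f M x) (orbit_map f M p)
      + dist (orbit_map f M x) (orbit_map f M q) + dist (orbit_map f M q) v"
    using dist_triangle [of u v "orbit_map f M x"]
      dist_triangle3 [of u "orbit_map f M x" "orbit_map f M p"]
      dist_triangle [of "orbit_map f M x" v "orbit_map f M q"]
    by (simp add: dist_commute)
  then have "dist (orbit_map f M x) (orbit_map f M p) > dist u v / 4 \<or>
      dist (orbit_map f M x) (orbit_map f M q) > dist u v / 4"
    using p(3) q(3) \<open>u \<noteq> v\<close> zero_less_dist_iff [of u v] unfolding e_def by linarith
  moreover have "p \<in> U" "q \<in> U" using p q d by (auto simp: e_def)
  ultimately show "\<exists>y\<in>U. \<exists>n\<ge>1. dist (orbit_map f n x) (orbit_map f n y) > dist u v / 4"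
    using \<open>M \<ge> 1\<close> by blast
qed

lemma periodic_system_mult:
  assumes "periodic_system X f k" and "n \<ge> 1" "x \<in> X"
  shows "f (k * m + n) x = f n x"
proof (induction m)
  case (Suc m)
  have "f ((k * m + n) + k) x = f (k * m + n) x"
    using assms unfolding periodic_system_def by (meson trans_le_add2)
  then show ?case using Suc by (simp add: algebra_simps)
qed simp

text \<open>At time \<open>k * m\<close> a whole number of periods has passed, so the maps applied
  next agree on \<open>X\<close> with \<open>f 1\<close>, \<open>f 2\<close>, and so on.\<close>

lemma orbit_map_period_add:
  assumes "periodic_system X f k" and "nonautonomous_system X f" and "x \<in> X"
  shows "orbit_map f (k * m + n) x = orbit_map f n (orbit_map f (k * m) x)"
proof (induction n)
  case (Suc n)
  have "orbit_map f (k * m + n) x \<in> X"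
    using orbit_map_image [OF assms(2)] \<open>x \<in> X\<close> by blast
  then have "f (k * m + Suc n) (orbit_map f (k * m + n) x)
      = f (Suc n) (orbit_map f (k * m + n) x)"
    by (intro periodic_system_mult [OF assms(1)]) auto
  then show ?case using Suc by simp
qed simp

text \<open>A point that returns once need not return again in a non-autonomous system. Here the
  return time is a multiple of \<open>k\<close>, so each further block of \<open>k * m\<close> steps
  repeats the first.\<close>

lemma fixed_imp_periodic_point:
  assumes "periodic_system X f k" and "nonautonomous_system X f" and "x \<in> X"
    and "m \<ge> 1" and "orbit_map f (k * m) x = x"
  shows "x \<in> periodic_points X f"
proof -
  have "orbit_map f (k * m * j) x = x" for j
  proof (induction j)
    case (Suc j)
    have "orbit_map f (k * m + k * m * j) x = x"
      using orbit_map_period_add [OF assms(1-3)] Suc assms(5) by simp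
    then show ?case by simp
  qed simp
  moreover have "k * m \<ge> 1"
    using assms unfolding periodic_system_def by simp
  ultimately show ?thesis
    using \<open>x \<in> X\<close> unfolding periodic_points_def by blast
qed

lemma mixing_interval_periodic_point:
  fixes f :: "nat \<Rightarrow> real \<Rightarrow> real"
  assumes mix: "mixing {a..b} f" and sys: "nonautonomous_system {a..b} f"
    and per: "periodic_system {a..b} f k"
    and x: "a < x" "x < b" and "\<epsilon> > 0"
  shows "\<exists>p\<in>periodic_points {a..b} f. dist p x < \<epsilon>"
proof -
  \<comment> \<open>Halving keeps the ball of radius \<open>e\<close> about \<open>x\<close> at
    distance at least \<open>e\<close> from both endpoints.\<close>
  define e where "e = min \<epsilon> (min ((x - a) / 2) ((b - x) / 2))"
  have "e > 0" using x \<open>\<epsilon> > 0\<close> by (simp add: e_def)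
  then obtain M where "M \<ge> 1" and M: "\<And>x y n. x \<in> {a..b} \<Longrightarrow> y \<in> {a..b} \<Longrightarrow> n \<ge> M \<Longrightarrow>
      \<exists>z\<in>{a..b}. dist z x < e \<and> dist (orbit_map f n z) y < e"
    using mixingE [OF mix] by metis
  \<comment> \<open>This time is large enough for mixing and a multiple of \<open>k\<close>, so that
    fixed points of \<open>?g\<close> are periodic points.\<close>
  let ?g = "orbit_map f (k * M)"
  have "k * M \<ge> M" using per by (simp add: periodic_system_def)
  then have near: "\<exists>z\<in>{a..b}. dist z x < e \<and> dist (?g z) y < e" if "y \<in> {a..b}" for y
    using M that x by simp
  have "a \<in> {a..b}" "b \<in> {a..b}" using x by auto
  obtain p where p: "p \<in> {a..b}" "dist p x < e" "dist (?g p) a < e"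
    using near [OF \<open>a \<in> {a..b}\<close>] by blast
  obtain q where q: "q \<in> {a..b}" "dist q x < e" "dist (?g q) b < e"
    using near [OF \<open>b \<in> {a..b}\<close>] by blast
  have e: "e \<le> \<epsilon>" "a + e \<le> x - e" "x + e \<le> b - e"
    by (auto simp: e_def min_def field_simps)
  \<comment> \<open>Indeed \<open>?g p < a + e \<le> x - e < p\<close>, and symmetrically for
    \<open>q\<close> at the right endpoint.\<close>
  have "?g p - p \<le> 0" "0 \<le> ?g q - q"
    using p q e by (auto simp: dist_real_def)
  \<comment> \<open>The order of \<open>p\<close> and \<open>q\<close> is unknown; a segment covers
    both cases.\<close>
  moreover have "connected ((\<lambda>z. ?g z - z) ` closed_segment p q)"
  proof (rule connected_continuous_image)
    have "closed_segment p q \<subseteq> {a..b}"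
      using p q by (simp add: closed_segment_subset convex_real_interval)
    then have "continuous_on (closed_segment p q) ?g"
      using continuous_on_orbit_map [OF sys] continuous_on_subset by blast
    then show "continuous_on (closed_segment p q) (\<lambda>z. ?g z - z)"
      by (rule continuous_on_diff) (rule continuous_on_id)
  qed (rule connected_segment)
  ultimately have "0 \<in> (\<lambda>z. ?g z - z) ` closed_segment p q"
    by (intro connectedD_interval [of _ "?g p - p" "?g q - q" 0]) auto
  then obtain z where z: "z \<in> closed_segment p q" "?g z = z" by auto
  have "closed_segment p q \<subseteq> ball x e \<inter> {a..b}"
    using p q by (intro closed_segment_subset) (auto simp: dist_commute convex_Int)
  then have "z \<in> {a..b}" "dist z x < \<epsilon>"
    using z e by (auto simp: dist_commute)
  then show ?thesis
    using fixed_imp_periodic_point [OF per sys _ \<open>M \<ge> 1\<close>] z by blast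
qed

lemma mixing_interval_imp_devaney_chaotic:
  fixes f :: "nat \<Rightarrow> real \<Rightarrow> real"
  assumes "mixing {a..b} f" and "nonautonomous_system {a..b} f"
    and "periodic_system {a..b} f k" and "a < b"
  shows "devaney_chaotic {a..b} f"
proof -
  \<comment> \<open>The endpoints are reached by taking the closure of the open interval.\<close>
  have "{a<..<b} \<subseteq> closure (periodic_points {a..b} f)"
    using mixing_interval_periodic_point [OF assms(1-3)] by (auto simp: closure_approachable)
  then have "{a..b} \<subseteq> closure (periodic_points {a..b} f)"
    using closure_minimal closed_closure closure_greaterThanLessThan [OF \<open>a < b\<close>] by metis
  moreover have "sensitive {a..b} f"
    using mixing_imp_sensitive [OF assms(1), of a b] \<open>a < b\<close> by simp
  ultimately show ?thesis
    using mixing_imp_transitive [OF assms(1,2)] by (simp add: devaney_chaotic_def)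
qed

text \<open>On a one-point interval both specification properties hold trivially while sensitivity
  fails; this is why two distinct points are required.\<close>

theorem theorem4p2:
  fixes I :: "real set" and f :: "nat \<Rightarrow> real \<Rightarrow> real" and k :: nat
  assumes "is_interval I" and "\<exists>u\<in>I. \<exists>v\<in>I. u < v"
    and "nonautonomous_system I f"
    and "periodic_system I f k"
  shows "(weak_specification I f \<longrightarrow> devaney_chaotic I f) \<and>
         (quasi_weak_specification I f \<longrightarrow> devaney_chaotic I f)"
proof -
  have "compact I" using assms(3) by (simp add: nonautonomous_system_def)
  then obtain a b where I: "I = {a..b}"
    using assms(1) connected_compact_interval_1 is_interval_connected_1 by metis
  have "a < b" using assms(2) I by force
  have "devaney_chaotic I f" if "quasi_weak_specification I f"
    using mixing_interval_imp_devaney_chaotic [of a b f k] \<open>a < b\<close> assms(3,4)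
      quasi_weak_specification_imp_mixing [OF assms(3) that] unfolding I by simp
  then show ?thesis
    using weak_specification_imp_quasi by blast
qed

end
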